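(* Consider the $n$-bus DC microgrid system $\dot x = Ax+Bv^{\mathrm{ref}}+Ch(p,x)$ with uncertain constant power loads $p\in\mathcal{P}$ and load-voltage constraint set $\mathcal{V}_l^e$. Let $\overline{A}_z=A+\sum_{k=1}^n\overline{\delta}_kD_{3n+k}$ and, for a symmetric matrix $P\in\mathbb{R}^{4n\times4n}$, let $G_k=PD_{3n+k}+D_{3n+k}P$, $k=1,\dots,n$. The system is locally robustly stable (every equilibrium in $\mathcal{X}_e(\mathcal{P},\mathcal{V}_l^e)$ is locally exponentially stable) if there exist $P=P^T\succ0$, $\gamma_0,\dots,\gamma_n>0$ and $\eta_1,\dots,\eta_n>0$ such that the following optimization problem is feasible (i.e. its constraints are satisfied): $$\min_{P,\gamma_0,\dots,\gamma_n,\eta_1,\dots,\eta_n}\ -\sum_{k=0}^n\gamma_k$$ subject to $$P\overline{A}_z+\overline{A}_z^TP\preceq-\gamma_0I_{4n},\qquad \sum_{k=1}^n\eta_k=\gamma_0,$$ $$\overline{\delta}_k\,G_k\succeq(\gamma_k-\eta_k)I_{4n},\quad k=1,\dots,n,$$ $$\gamma_k>0,\ \eta_k>0,\quad k=1,\dots,n,\qquad P=P^T,\ P\succ0,\ \gamma_0>0.$$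
   Context: Microgrid model. Let $n\ge 1$ and let $\mathcal{G}=(\mathcal{V},\mathcal{E})$ be an undirected graph on $\{1,\dots,n\}$ without self-loops; $\mathcal{N}_k$ is the set of neighbours of $k$. For each $k$ let $L_{sk},r_{sk},L_{lk},r_{lk},C_{lk},C_{bk}>0$ be constants, let $r_{kj}=r_{jk}>0$ for $(k,j)\in\mathcal{E}$, and let $d_k$ (droop gain) and $v_k^{\mathrm{ref}}$ be real constants. The dynamics of bus $k$ are $$L_{sk}\frac{di_{sk}}{dt}=v_k^{\mathrm{ref}}-(r_{sk}+d_k)i_{sk}-v_{bk},\qquad L_{lk}\frac{di_{lk}}{dt}=v_{bk}-r_{lk}i_{lk}-v_{lk},$$ $$C_{bk}\frac{dv_{bk}}{dt}=i_{sk}-i_{lk}-\sum_{j\in\mathcal{N}_k}\frac{v_{bk}-v_{bj}}{r_{kj}},\qquad C_{lk}\frac{dv_{lk}}{dt}=i_{lk}-\frac{p_k}{v_{lk}},$$ where $p_k$ is the (constant in time) power of the $k$-th load. The state is $x=[i_{s1},\dots,i_{sn},i_{l1},\dots,i_{ln},v_{b1},\dots,v_{bn},v_{l1},\dots,v_{ln}]^T\in\mathbb{R}^{4n}$. With $p=[p_1,\dots,p_n]^T$, $v^{\mathrm{ref}}=[v_1^{\mathrm{ref}},\dots,v_n^{\mathrm{ref}}]^T$ and $h(p,x)=[-p_1/v_{l1},\dots,-p_n/v_{ln}]^T$, these equations are written as $\dot x=Ax+Bv^{\mathrm{ref}}+Ch(p,x)$, with constant matrices $A\in\mathbb{R}^{4n\times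 4n}$, $B,C\in\mathbb{R}^{4n\times n}$ read off from the equations above (so the only nonzero entries of $C$ are $C_{3n+k,k}=1/C_{lk}$). Uncertainty. $\mathcal{P}=\{p\in\mathbb{R}^n: p_k\in[\underline{p_k},\overline{p_k}],\ k=1,\dots,n\}$ with $\overline{p_k}\ge\underline{p_k}\ge 0$, and $\mathcal{V}_l^e=\{v_l^e\in\mathbb{R}^n: v_{lk}^e\in[\underline{v_{lk}^e},\overline{v_{lk}^e}],\ k=1,\dots,n\}$ with $\overline{v_{lk}^e}\ge\underline{v_{lk}^e}>0$. For an equilibrium $x_e\in\mathbb{R}^{4n}$, $v_l^e=[v_{l1}^e,\dots,v_{ln}^e]^T$ denotes its load-voltage components (its last $n$ entries). Define $$\mathcal{X}_e(\mathcal{P},\mathcal{V}_l^e)=\{x_e\in\mathbb{R}^{4n}: Ax_e+Bv^{\mathrm{ref}}+Ch(p,x_e)=0 \text{ for some } p\in\mathcal{P},\ v_l^e\in\mathcal{V}_l^e\}.$$ The system is called locally robustly stable if every $x_e\in\mathcal{X}_e(\mathcal{P},\mathcal{V}_l^e)$ is a locally exponentially stable equilibrium (of the system with the corresponding $p$). Notation. $D_m\in\mathbb{R}^{4n\times 4n}$ is the matrix whose only nonzero entry is its $m$-th diagonal entry, equal to $1$. $\overline{\delta}_k=\overline{p_k}/(C_{lk}(\underline{v_{lk}^e})^2)$. $I_{4n}$ is the identity; $M\succ0$ means positive definite, and $M\preceq N$ (equivalently $N\succeq M$) means $N-M$ is positive semidefinite. *)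

theory Defs
  imports "HOL-Analysis.Analysis"
begin

text \<open>
  The bus set is the universe of a finite type \<open>'n\<close>. The coordinates of the state space of
  dimension \<open>4 * CARD('n)\<close> are indexed by four tagged copies of \<open>'n\<close>, one per block of state
  variables; in a linear numbering \<open>1, ..., 4n\<close> the index \<open>VL k\<close> is \<open>3n + k\<close>.
\<close>

datatype 'n coord = IS 'n | IL 'n | VB 'n | VL 'n

lemma UNIV_coord: "UNIV = range IS \<union> range IL \<union> range VB \<union> range VL"
proof -
  have "i \<in> range IS \<union> range IL \<union> range VB \<union> range VL" for i :: "'a coord"
    by (cases i) simp_all
  then show ?thesis by blast
qed

instance coord :: (finite) finite
  by standard (simp add: UNIV_coord)

lemma sum_coord:
  fixes f :: "'n::finite coord \<Rightarrow> 'b::comm_monoid_add"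
  shows "(\<Sum>i\<in>UNIV. f i) =
    (\<Sum>k\<in>UNIV. f (IS k)) + (\<Sum>k\<in>UNIV. f (IL k)) +
    (\<Sum>k\<in>UNIV. f (VB k)) + (\<Sum>k\<in>UNIV. f (VL k))"
proof -
  have "(\<Sum>i\<in>UNIV. f i) = sum f (range IS) + sum f (range IL) + sum f (range VB) + sum f (range VL)"
    unfolding UNIV_coord
    by (subst sum.union_disjoint, simp, simp, blast)+ simp
  then show ?thesis
    by (simp add: sum.reindex inj_def)
qed


section \<open>The microgrid\<close>

record 'n microgrid =
  adj :: "'n \<Rightarrow> 'n \<Rightarrow> bool"
  Ls :: "'n \<Rightarrow> real"
  rs :: "'n \<Rightarrow> real"
  Ll :: "'n \<Rightarrow> real"
  rl :: "'n \<Rightarrow> real"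
  Cl :: "'n \<Rightarrow> real"
  Cb :: "'n \<Rightarrow> real"
  rline :: "'n \<Rightarrow> 'n \<Rightarrow> real"
  droop :: "'n \<Rightarrow> real"

definition wf_microgrid :: "'n microgrid \<Rightarrow> bool" where
  "wf_microgrid M \<longleftrightarrow>
     (\<forall>k j. adj M k j \<longrightarrow> adj M j k) \<and> (\<forall>k. \<not> adj M k k) \<and>
     (\<forall>k. Ls M k > 0 \<and> rs M k > 0 \<and> Ll M k > 0 \<and> rl M k > 0 \<and> Cl M k > 0 \<and> Cb M k > 0) \<and>
     (\<forall>k j. adj M k j \<longrightarrow> rline M k j > 0 \<and> rline M k j = rline M j k)"

fun A_entry :: "'n::finite microgrid \<Rightarrow> 'n coord \<Rightarrow> 'n coord \<Rightarrow> real" where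
  "A_entry M (IS k) (IS j) = (if j = k then - (rs M k + droop M k) / Ls M k else 0)"
| "A_entry M (IS k) (VB j) = (if j = k then - 1 / Ls M k else 0)"
| "A_entry M (IL k) (IL j) = (if j = k then - rl M k / Ll M k else 0)"
| "A_entry M (IL k) (VB j) = (if j = k then 1 / Ll M k else 0)"
| "A_entry M (IL k) (VL j) = (if j = k then - 1 / Ll M k else 0)"
| "A_entry M (VB k) (IS j) = (if j = k then 1 / Cb M k else 0)"
| "A_entry M (VB k) (IL j) = (if j = k then - 1 / Cb M k else 0)"
| "A_entry M (VB k) (VB j) =
     ((if adj M k j then 1 / rline M k j else 0) -
      (if j = k then \<Sum>l\<in>{l. adj M k l}. 1 / rline M k l else 0)) / Cb M k"
| "A_entry M (VL k) (IL j) = (if j = k then 1 / Cl M k else 0)"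
| "A_entry M _ _ = 0"

definition A_mat :: "'n::finite microgrid \<Rightarrow> real ^ 'n coord ^ 'n coord" where
  "A_mat M = (\<chi> i j. A_entry M i j)"

definition B_mat :: "'n::finite microgrid \<Rightarrow> real ^ 'n ^ 'n coord" where
  "B_mat M = (\<chi> i j. if i = IS j then 1 / Ls M j else 0)"

definition C_mat :: "'n::finite microgrid \<Rightarrow> real ^ 'n ^ 'n coord" where
  "C_mat M = (\<chi> i j. if i = VL j then 1 / Cl M j else 0)"

definition load_h :: "real ^ 'n \<Rightarrow> real ^ 'n coord \<Rightarrow> real ^ 'n::finite" where
  "load_h p x = (\<chi> k. - p $ k / x $ VL k)"

definition mg_field ::
  "'n::finite microgrid \<Rightarrow> real ^ 'n \<Rightarrow> real ^ 'n \<Rightarrow> real ^ 'n coord \<Rightarrow> real ^ 'n coord" where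
  "mg_field M vref p x = A_mat M *v x + B_mat M *v vref + C_mat M *v load_h p x"

text \<open>
  The constant power loads are undefined at load voltage zero, whereas division in HOL is total;
  trajectories are therefore confined to the following set.
\<close>

definition mg_domain :: "(real ^ 'n::finite coord) set" where
  "mg_domain = {x. \<forall>k. x $ VL k \<noteq> 0}"

text \<open>The matrix form agrees with the circuit equations of the individual buses.\<close>

lemma mg_field_circuit_equations:
  fixes M :: "'n::finite microgrid"
  assumes "wf_microgrid M"
  shows "Ls M k * mg_field M vref p x $ IS k =
           vref $ k - (rs M k + droop M k) * x $ IS k - x $ VB k"
    and "Ll M k * mg_field M vref p x $ IL k = x $ VB k - rl M k * x $ IL k - x $ VL k"
    and "Cb M k * mg_field M vref p x $ VB k =
           x $ IS k - x $ IL k - (\<Sum>j\<in>{j. adj M k j}. (x $ VB k - x $ VB j) / rline M k j)"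
    and "Cl M k * mg_field M vref p x $ VL k = x $ IL k - p $ k / x $ VL k"
proof -
  have pos: "Ls M k > 0" "Ll M k > 0" "Cb M k > 0" "Cl M k > 0"
    using assms by (auto simp: wf_microgrid_def)
  have if_mult: "(if b then c else 0) * d = (if b then c * d else 0)" 
    and if_div: "- ((if b then c else 0) / d) = (if b then - (c / d) else 0)" for b and c d :: real
    by simp_all
  have nth: "mg_field M vref p x $ i =
      (\<Sum>j\<in>UNIV. A_entry M i (IS j) * x $ IS j) + (\<Sum>j\<in>UNIV. A_entry M i (IL j) * x $ IL j) +
      (\<Sum>j\<in>UNIV. A_entry M i (VB j) * x $ VB j) + (\<Sum>j\<in>UNIV. A_entry M i (VL j) * x $ VL j) +
      (\<Sum>j\<in>UNIV. (if i = IS j then 1 / Ls M j else 0) * vref $ j) +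
      (\<Sum>j\<in>UNIV. (if i = VL j then 1 / Cl M j else 0) * (- p $ j / x $ VL j))" for i
    by (simp only: mg_field_def A_mat_def B_mat_def C_mat_def load_h_def matrix_vector_mult_def
        sum_coord vector_add_component vec_lambda_beta)
  have IS: "mg_field M vref p x $ IS k =
      - (rs M k + droop M k) / Ls M k * x $ IS k + - 1 / Ls M k * x $ VB k + 1 / Ls M k * vref $ k"
    by (simp add: nth if_mult del: times_divide_eq_left)
  show "Ls M k * mg_field M vref p x $ IS k =
          vref $ k - (rs M k + droop M k) * x $ IS k - x $ VB k"
    unfolding IS using pos by (simp add: field_simps)
  have IL: "mg_field M vref p x $ IL k =
      - rl M k / Ll M k * x $ IL k + 1 / Ll M k * x $ VB k + - 1 / Ll M k * x $ VL k"
    by (simp add: nth if_mult del: times_divide_eq_left)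
  show "Ll M k * mg_field M vref p x $ IL k = x $ VB k - rl M k * x $ IL k - x $ VL k"
    unfolding IL using pos by (simp add: field_simps)
  have VL: "mg_field M vref p x $ VL k = 1 / Cl M k * x $ IL k + 1 / Cl M k * (- p $ k / x $ VL k)"
    by (simp add: nth if_mult if_div del: times_divide_eq_left)
  show "Cl M k * mg_field M vref p x $ VL k = x $ IL k - p $ k / x $ VL k"
    unfolding VL using pos by (simp add: right_diff_distrib)
  let ?S = "\<Sum>l\<in>{l. adj M k l}. 1 / rline M k l"
  have "(\<Sum>j\<in>UNIV. A_entry M (VB k) (VB j) * x $ VB j) =
      (\<Sum>j\<in>UNIV. ((if adj M k j then x $ VB j / rline M k j else 0) -
        (if j = k then ?S * x $ VB j else 0)) / Cb M k)"
    by (rule sum.cong) (auto simp: left_diff_distrib)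
  also have "\<dots> = ((\<Sum>j\<in>UNIV. if adj M k j then x $ VB j / rline M k j else 0) -
      (\<Sum>j\<in>UNIV. if j = k then ?S * x $ VB j else 0)) / Cb M k"
    by (simp only: sum_divide_distrib[symmetric] sum_subtractf)
  also have "(\<Sum>j\<in>UNIV. if adj M k j then x $ VB j / rline M k j else 0) =
      (\<Sum>j\<in>{j. adj M k j}. x $ VB j / rline M k j)"
    by (simp add: sum.If_cases)
  also have "(\<Sum>j\<in>UNIV. if j = k then ?S * x $ VB j else 0) =
      (\<Sum>j\<in>{j. adj M k j}. x $ VB k / rline M k j)"
    by (simp add: sum_distrib_right)
  finally have *: "(\<Sum>j\<in>UNIV. A_entry M (VB k) (VB j) * x $ VB j) =
      - (\<Sum>j\<in>{j. adj M k j}. (x $ VB k - x $ VB j) / rline M k j) / Cb M k"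
    by (simp add: diff_divide_distrib sum_subtractf)
  have VB: "mg_field M vref p x $ VB k = 1 / Cb M k * x $ IS k + - 1 / Cb M k * x $ IL k +
      - (\<Sum>j\<in>{j. adj M k j}. (x $ VB k - x $ VB j) / rline M k j) / Cb M k"
    unfolding nth * by (simp add: if_mult del: times_divide_eq_left)
  show "Cb M k * mg_field M vref p x $ VB k =
      x $ IS k - x $ IL k - (\<Sum>j\<in>{j. adj M k j}. (x $ VB k - x $ VB j) / rline M k j)"
    unfolding VB using pos by (simp add: distrib_left right_diff_distrib)
qed


section \<open>Local exponential stability\<close>

definition ode_solution ::
  "('a::real_normed_vector \<Rightarrow> 'a) \<Rightarrow> 'a set \<Rightarrow> real set \<Rightarrow> (real \<Rightarrow> 'a) \<Rightarrow> bool" where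
  "ode_solution f S I x \<longleftrightarrow>
     (\<forall>t\<in>I. x t \<in> S \<and> (x has_vector_derivative f (x t)) (at t within I))"

text \<open>
  The bound is demanded of every solution on every compact interval starting at time 0, hence of
  every forward solution on any interval. The existence of a solution for all nonnegative times is
  part of the notion, so that the bound is never vacuous; it also forces a neighbourhood of the
  equilibrium to lie in \<open>S\<close>.
\<close>

definition locally_exp_stable ::
  "('a::real_normed_vector \<Rightarrow> 'a) \<Rightarrow> 'a set \<Rightarrow> 'a \<Rightarrow> bool" where
  "locally_exp_stable f S xe \<longleftrightarrow>
     xe \<in> S \<and> f xe = 0 \<and>
     (\<exists>c>0. \<exists>K>0. \<exists>\<mu>>0. \<forall>x0. norm (x0 - xe) < c \<longrightarrow>
        (\<exists>x. x 0 = x0 \<and> ode_solution f S {0..} x) \<and>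
        (\<forall>T>0. \<forall>x. x 0 = x0 \<and> ode_solution f S {0..T} x \<longrightarrow>
           (\<forall>t\<in>{0..T}. norm (x t - xe) \<le> K * exp (- \<mu> * t) * norm (x0 - xe))))"


section \<open>Uncertainty and robust stability\<close>

text \<open>The power set and the load-voltage set are both of this form.\<close>

definition box_set :: "real ^ 'n \<Rightarrow> real ^ 'n \<Rightarrow> (real ^ 'n::finite) set" where
  "box_set lo hi = {p. \<forall>k. lo $ k \<le> p $ k \<and> p $ k \<le> hi $ k}"

definition load_voltages :: "real ^ 'n coord \<Rightarrow> real ^ 'n::finite" where
  "load_voltages x = (\<chi> k. x $ VL k)"

definition equilibria ::
  "'n::finite microgrid \<Rightarrow> real ^ 'n \<Rightarrow> (real ^ 'n) set \<Rightarrow> (real ^ 'n) set \<Rightarrow> (real ^ 'n coord) set"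
where
  "equilibria M vref PP VV =
     {xe. load_voltages xe \<in> VV \<and> (\<exists>p\<in>PP. mg_field M vref p xe = 0)}"

definition locally_robustly_stable ::
  "'n::finite microgrid \<Rightarrow> real ^ 'n \<Rightarrow> (real ^ 'n) set \<Rightarrow> (real ^ 'n) set \<Rightarrow> bool" where
  "locally_robustly_stable M vref PP VV \<longleftrightarrow>
     (\<forall>xe\<in>equilibria M vref PP VV. \<forall>p\<in>PP. mg_field M vref p xe = 0 \<longrightarrow>
        locally_exp_stable (mg_field M vref p) mg_domain xe)"


section \<open>Matrix inequalities\<close>

definition pos_semidef :: "real ^ 'm ^ 'm::finite \<Rightarrow> bool" where
  "pos_semidef Q \<longleftrightarrow> transpose Q = Q \<and> (\<forall>x. x \<bullet> (Q *v x) \<ge> 0)"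

definition pos_def :: "real ^ 'm ^ 'm::finite \<Rightarrow> bool" where
  "pos_def Q \<longleftrightarrow> transpose Q = Q \<and> (\<forall>x. x \<noteq> 0 \<longrightarrow> x \<bullet> (Q *v x) > 0)"

definition loewner_le :: "real ^ 'm ^ 'm \<Rightarrow> real ^ 'm ^ 'm::finite \<Rightarrow> bool" (infix "\<preceq>\<^sub>L" 50) where
  "Q \<preceq>\<^sub>L R \<longleftrightarrow> pos_semidef (R - Q)"

definition diag_unit :: "'m::finite \<Rightarrow> real ^ 'm ^ 'm" where
  "diag_unit m = (\<chi> i j. if i = m \<and> j = m then 1 else 0)"

definition delta_bar ::
  "'n::finite microgrid \<Rightarrow> real ^ 'n \<Rightarrow> real ^ 'n \<Rightarrow> 'n \<Rightarrow> real" where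
  "delta_bar M p_hi v_lo k = p_hi $ k / (Cl M k * (v_lo $ k)\<^sup>2)"

definition Az_bar ::
  "'n::finite microgrid \<Rightarrow> real ^ 'n \<Rightarrow> real ^ 'n \<Rightarrow> real ^ 'n coord ^ 'n coord" where
  "Az_bar M p_hi v_lo =
     A_mat M + (\<Sum>k\<in>UNIV. delta_bar M p_hi v_lo k *\<^sub>R diag_unit (VL k))"

definition G_mat :: "real ^ 'n coord ^ 'n coord \<Rightarrow> 'n \<Rightarrow> real ^ 'n coord ^ 'n::finite coord" where
  "G_mat P k = P ** diag_unit (VL k) + diag_unit (VL k) ** P"

end

theory Submission
  imports Defs
begin

text \<open>
  The argument is Lyapunov's indirect method with the single quadratic form
  \<open>V z = z \<bullet> (P *v z)\<close> for all admissible loads and equilibria.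

  At an equilibrium with load voltages \<open>v\<^sub>k\<close> the Jacobian is \<open>A\<close> plus the diagonal entries
  \<open>d\<^sub>k = p\<^sub>k / (C\<^sub>l\<^sub>k v\<^sub>k\<^sup>2)\<close> at the positions \<open>VL k\<close>, and \<open>0 \<le> d\<^sub>k \<le> \<delta>\<^sub>k\<close>, where \<open>\<delta>\<^sub>k\<close> is
  \<open>delta_bar\<close>. It is therefore the worst-case matrix \<open>Az_bar\<close> minus
  \<open>\<Sum>k. (\<delta>\<^sub>k - d\<^sub>k) D\<^sub>k\<close>, where \<open>D\<^sub>k\<close> is the diagonal unit of \<open>VL k\<close>. Write
  \<open>\<delta>\<^sub>k - d\<^sub>k = \<theta>\<^sub>k \<delta>\<^sub>k\<close> with \<open>0 \<le> \<theta>\<^sub>k \<le> 1\<close>. The matrix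
  inequalities bound the quadratic form of \<open>P J + J\<^sup>T P\<close>, for the Jacobian \<open>J\<close>, by
  \<open>- (\<Sum>k. \<eta>\<^sub>k) - (\<Sum>k. \<theta>\<^sub>k (\<gamma>\<^sub>k - \<eta>\<^sub>k)) = - (\<Sum>k. (1 - \<theta>\<^sub>k) \<eta>\<^sub>k + \<theta>\<^sub>k \<gamma>\<^sub>k)\<close> times the squared norm, and
  each summand is at least \<open>min \<gamma>\<^sub>k \<eta>\<^sub>k > 0\<close>. This is \<open>jacobian_lyapunov_inequality\<close>.

  That such an inequality for the derivative at an equilibrium gives local exponential stability is
  \<open>lyapunov_indirect_method\<close>. Near the equilibrium the linear part dominates the remainder, so
  \<open>V\<close> decays exponentially along every solution that starts in a small enough sublevel set;
  \<open>exp_decay_below_level\<close> shows that the solution cannot leave it. Solutions for all nonnegative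
  times exist because the vector field may be replaced, outside a small ball, so as to become
  globally Lipschitz, and then the Picard operator is a contraction in an exponentially weighted
  supremum norm
  (\<open>lipschitz_ode_global_solution\<close>); the decay estimate keeps the solution in the ball, where the
  two fields agree.
\<close>

section \<open>Scalar decay and global solutions of Lipschitz equations\<close>

text \<open>
  The decay inequality is only assumed below the level \<open>r\<close>. That \<open>V\<close> never reaches this level
  follows by considering the first time at which it would.
\<close>

lemma exp_decay_below_level:
  fixes V V' :: "real \<Rightarrow> real"
  assumes der: "\<And>t. t \<in> {0..T} \<Longrightarrow> (V has_real_derivative V' t) (at t within {0..T})"
    and decay: "\<And>t. t \<in> {0..T} \<Longrightarrow> V t < r \<Longrightarrow> V' t \<le> - \<kappa> * V t"
    and V0: "0 \<le> V 0" "V 0 < r" and \<kappa>: "0 \<le> \<kappa>" and t: "t \<in> {0..T}"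
  shows "V t \<le> exp (- \<kappa> * t) * V 0"
proof -
  have cont: "continuous_on {0..T} V"
    by (rule DERIV_continuous_on) (use der in auto)
  have until: "V s \<le> exp (- \<kappa> * s) * V 0"
    if s: "s \<in> {0..T}" and below: "\<And>u. 0 \<le> u \<Longrightarrow> u < s \<Longrightarrow> V u < r" for s
  proof -
    have "exp (\<kappa> * s) * V s \<le> exp (\<kappa> * 0) * V 0"
    proof (rule DERIV_nonpos_imp_decreasing_open[where f = "\<lambda>u. exp (\<kappa> * u) * V u"])
      show "0 \<le> s" using s by simp
      show "continuous_on {0..s} (\<lambda>u. exp (\<kappa> * u) * V u)"
        using s by (intro continuous_intros continuous_on_subset[OF cont]) auto
      fix u assume u: "0 < u" "u < s"
      have "(V has_real_derivative V' u) (at u)"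
        using der[of u] u s at_within_Icc_at[of 0 u T] by auto
      then have "((\<lambda>u. exp (\<kappa> * u) * V u) has_real_derivative
          exp (\<kappa> * u) * (\<kappa> * V u + V' u)) (at u)"
        by (auto intro!: derivative_eq_intros simp: algebra_simps)
      moreover have "exp (\<kappa> * u) * (\<kappa> * V u + V' u) \<le> 0"
        using decay[of u] below[of u] u s by (intro mult_nonneg_nonpos) auto
      ultimately show "\<exists>y. ((\<lambda>u. exp (\<kappa> * u) * V u) has_real_derivative y) (at u) \<and> y \<le> 0"
        by blast
    qed
    then show ?thesis by (simp add: exp_minus field_simps)
  qed
  have "V s < r" if s: "s \<in> {0..T}" for s
  proof (rule ccontr)
    assume "\<not> V s < r"
    define S where "S = {0..T} \<inter> V -` {r..}"
    have "closed S"
      unfolding S_def by (rule continuous_closed_preimage[OF cont]) auto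
    then have "compact S"
      using compact_Int_closed[of "{0..T}" S] by (simp add: S_def Int_absorb1 flip: Int_assoc)
    moreover have "S \<noteq> {}" using s \<open>\<not> V s < r\<close> by (auto simp: S_def)
    ultimately obtain u where u: "u \<in> S" and least: "\<And>w. w \<in> S \<Longrightarrow> u \<le> w"
      using compact_attains_inf by metis
    have "V w < r" if "0 \<le> w" "w < u" for w
      using least[of w] that u by (force simp: S_def)
    then have "V u \<le> exp (- \<kappa> * u) * V 0"
      using until[of u] u by (auto simp: S_def)
    also have "\<dots> \<le> 1 * V 0"
      using u \<kappa> V0 by (intro mult_right_mono) (auto simp: S_def)
    finally show False using u V0 by (auto simp: S_def)
  qed
  with until[OF t] t show ?thesis by auto
qed

lemma exp_weighted_integral_bound:
  fixes h :: "real \<Rightarrow> 'a::banach"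
  assumes h: "continuous_on {0..t} h" and bound: "\<And>s. s \<in> {0..t} \<Longrightarrow> norm (h s) \<le> B * exp (a * s)"
    and "0 < a" "0 \<le> t" "0 \<le> B"
  shows "exp (- a * t) * norm (integral {0..t} h) \<le> B / a"
proof -
  have I: "((\<lambda>s. B * exp (a * s)) has_integral B / a * exp (a * t) - B / a * exp (a * 0)) {0..t}"
    using assms by (intro fundamental_theorem_of_calculus)
      (auto intro!: derivative_eq_intros simp: has_real_derivative_iff_has_vector_derivative[symmetric])
  have "norm (integral {0..t} h) \<le> integral {0..t} (\<lambda>s. B * exp (a * s))"
    using I by (intro integral_norm_bound_integral integrable_continuous_real h bound continuous_intros)
  also have "\<dots> \<le> B / a * exp (a * t)"
    using integral_unique[OF I] assms by simp
  finally have "exp (- a * t) * norm (integral {0..t} h) \<le> exp (- a * t) * (B / a * exp (a * t))"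
    by (intro mult_left_mono) auto
  then show ?thesis by (simp add: exp_minus field_simps)
qed

lemma has_vector_derivative_integral_atLeast:
  fixes h :: "real \<Rightarrow> 'a::banach"
  assumes h: "continuous_on {0..} h" and t: "0 \<le> t"
  shows "((\<lambda>u. integral {0..u} h) has_vector_derivative h t) (at t within {0..})"
proof -
  have "((\<lambda>u. integral {0..u} h) has_vector_derivative h t) (at t within {0..t+1})"
    using t by (intro integral_has_vector_derivative continuous_on_subset[OF h]) auto
  moreover have "at t within {0..t+1} = at t within {0..}"
    using t by (intro at_within_nhd[of t "{..<t+1}"]) auto
  ultimately show ?thesis by simp
qed

text \<open>
  Substituting \<open>y t = exp (a * t) *\<^sub>R u t\<close> with \<open>a\<close> twice a Lipschitz constant makes the Picard
  operator a contraction with factor \<open>1 / 2\<close> on bounded continuous functions, and so gives the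
  solution on the whole half-line in one step.
\<close>

lemma lipschitz_ode_global_solution:
  fixes g :: "'a::banach \<Rightarrow> 'a"
  assumes "L-lipschitz_on UNIV g"
  obtains y where "y 0 = y0"
    "\<And>t. 0 \<le> t \<Longrightarrow> (y has_vector_derivative g (y t)) (at t within {0..})"
proof -
  \<comment> \<open>\<open>L\<close> may be 0, whereas the weight needs a positive rate.\<close>
  define K where "K = L + 1"
  have K: "K > 0" using lipschitz_on_nonneg[OF assms] by (simp add: K_def)
  have lip: "norm (g x - g y) \<le> K * norm (x - y)" for x y
    using lipschitz_on_normD[OF lipschitz_on_mono[OF assms, of UNIV K]] by (simp add: K_def)
  have contg: "continuous_on UNIV g"
    by (rule lipschitz_on_continuous_on[OF assms])
  define a where "a = 2 * K"
  have a: "a > 0" using K by (simp add: a_def)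
  define h where "h u s = g (exp (a * s) *\<^sub>R apply_bcontfun u s)" for u :: "real \<Rightarrow>\<^sub>C 'a" and s
  have cont_h: "continuous_on S (h u)" for u S
    unfolding h_def
    by (intro continuous_on_compose2[OF contg] continuous_intros) auto
  define F where "F u t = exp (- a * t) *\<^sub>R (y0 + integral {0..t} (h u))" for u t
  have cont_F: "continuous_on {0..} (F u)" for u
  proof -
    have "continuous_on {0..} (\<lambda>t. integral {0..t} (h u))"
      unfolding continuous_on_eq_continuous_within
      by (auto intro!: has_vector_derivative_continuous has_vector_derivative_integral_atLeast cont_h)
    then show ?thesis unfolding F_def by (intro continuous_intros)
  qed
  have bound_F: "norm (F u t) \<le> norm y0 + (norm (g 0) + K * norm u) / a" if t: "0 \<le> t" for u t
  proof -
    have "norm (h u s) \<le> (norm (g 0) + K * norm u) * exp (a * s)" if "s \<in> {0..t}" for s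
    proof -
      have e: "exp (a * s) \<ge> 1" using that a by auto
      have "norm (h u s) \<le> norm (g 0) + K * norm (exp (a * s) *\<^sub>R u s)"
        using lip[of "exp (a * s) *\<^sub>R u s" 0] norm_triangle_ineq2[of "h u s" "g 0"]
        by (simp add: h_def)
      also have "\<dots> \<le> norm (g 0) * exp (a * s) + K * (exp (a * s) * norm u)"
        using e K norm_bounded[of u s] by (intro add_mono mult_left_mono) (auto simp: mult_le_cancel_left1)
      finally show ?thesis by (simp add: algebra_simps)
    qed
    then have "exp (- a * t) * norm (integral {0..t} (h u)) \<le> (norm (g 0) + K * norm u) / a"
      using a K t by (intro exp_weighted_integral_bound cont_h) auto
    moreover have "exp (- a * t) * norm y0 \<le> norm y0"
      using a t by (simp add: mult_left_le_one_le)
    moreover have "norm (F u t) \<le> exp (- a * t) * (norm y0 + norm (integral {0..t} (h u)))"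
      unfolding F_def norm_scaleR by (intro mult_mono norm_triangle_ineq) auto
    ultimately show ?thesis by (simp add: algebra_simps)
  qed
  \<comment> \<open>Bounded continuous functions live on the whole line; for negative times the value at 0 is used.\<close>
  define \<Phi> where "\<Phi> u = Bcontfun (\<lambda>t. F u (max t 0))" for u
  have \<Phi>: "apply_bcontfun (\<Phi> u) t = F u (max t 0)" for u t
  proof -
    have "(\<lambda>t. F u (max t 0)) \<in> bcontfun"
      by (intro bcontfun_normI[OF _ bound_F] continuous_on_compose2[OF cont_F] continuous_intros) auto
    then show ?thesis by (simp add: \<Phi>_def Bcontfun_inverse)
  qed
  have "dist (\<Phi> u) (\<Phi> v) \<le> 1 / 2 * dist u v" for u v
  proof (rule dist_bound)
    fix t :: real
    define \<tau> where "\<tau> = max t 0"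
    have \<tau>: "0 \<le> \<tau>" by (simp add: \<tau>_def)
    have "norm (h u s - h v s) \<le> (K * dist u v) * exp (a * s)" for s
    proof -
      have "norm (h u s - h v s) \<le> K * norm (exp (a * s) *\<^sub>R (u s - v s))"
        using lip by (metis h_def scaleR_diff_right)
      also have "\<dots> \<le> K * (exp (a * s) * dist u v)"
        using K dist_bounded[of u s v] by (intro mult_left_mono) (auto simp: dist_norm)
      finally show ?thesis by (simp add: algebra_simps)
    qed
    then have "exp (- a * \<tau>) * norm (integral {0..\<tau>} (\<lambda>s. h u s - h v s)) \<le> (K * dist u v) / a"
      using a K \<tau> by (intro exp_weighted_integral_bound continuous_intros cont_h) auto
    moreover have "integral {0..\<tau>} (\<lambda>s. h u s - h v s) = integral {0..\<tau>} (h u) - integral {0..\<tau>} (h v)"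
      by (intro Henstock_Kurzweil_Integration.integral_diff integrable_continuous_real cont_h)
    ultimately have "norm (F u \<tau> - F v \<tau>) \<le> (K * dist u v) / a"
      by (simp add: F_def flip: scaleR_diff_right)
    then show "dist (\<Phi> u t) (\<Phi> v t) \<le> 1 / 2 * dist u v"
      using K by (simp add: \<Phi> a_def dist_norm flip: \<tau>_def)
  qed
  then obtain u where u: "\<Phi> u = u"
    using banach_fix_type[of "1/2" \<Phi>] by auto
  define y where "y t = exp (a * t) *\<^sub>R apply_bcontfun u t" for t
  have y: "y t = y0 + integral {0..t} (h u)" if "0 \<le> t" for t
    using \<Phi>[of u t] that by (simp add: u F_def y_def exp_minus)
  show thesis
  proof
    show "y 0 = y0" by (simp add: y)
    fix t :: real assume t: "0 \<le> t"
    have "((\<lambda>t. y0 + integral {0..t} (h u)) has_vector_derivative 0 + h u t) (at t within {0..})"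
      using t by (intro has_vector_derivative_add has_vector_derivative_integral_atLeast cont_h) auto
    then have "(y has_vector_derivative 0 + h u t) (at t within {0..})"
      by (rule has_vector_derivative_transform[rotated 2]) (use t y in auto)
    then show "(y has_vector_derivative g (y t)) (at t within {0..})"
      by (simp add: h_def y_def)
  qed
qed

section \<open>Lyapunov's indirect method\<close>

lemma pos_def_lower_bound:
  fixes P :: "real ^ 'm ^ 'm::finite"
  assumes "pos_def P"
  obtains l where "0 < l" "\<And>y. l * (norm y)\<^sup>2 \<le> y \<bullet> (P *v y)"
proof -
  have "continuous_on (sphere 0 1) (\<lambda>y. y \<bullet> (P *v y))"
    by (intro continuous_intros linear_continuous_on matrix_vector_mul_bounded_linear)
  moreover have "sphere (0 :: real ^ 'm) 1 \<noteq> {}" by simp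
  ultimately obtain u where "u \<in> sphere 0 1"
      "\<forall>y\<in>sphere 0 1. u \<bullet> (P *v u) \<le> y \<bullet> (P *v y)"
    using continuous_attains_inf[OF compact_sphere] by blast
  then have u: "norm u = 1" and min: "\<And>y. norm y = 1 \<Longrightarrow> u \<bullet> (P *v u) \<le> y \<bullet> (P *v y)"
    by auto
  show thesis
  proof
    show "0 < u \<bullet> (P *v u)"
      using assms u by (simp add: pos_def_def) (metis norm_zero zero_neq_one)
    fix y
    show "u \<bullet> (P *v u) * (norm y)\<^sup>2 \<le> y \<bullet> (P *v y)"
    proof (cases "y = 0")
      case False
      define w where "w = y /\<^sub>R norm y"
      have y: "y = norm y *\<^sub>R w" using False by (simp add: w_def)
      have "norm w = 1" using False by (simp add: w_def)
      then have "(norm y)\<^sup>2 * (u \<bullet> (P *v u)) \<le> (norm y)\<^sup>2 * (w \<bullet> (P *v w))"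
        by (intro mult_left_mono min) simp_all
      also have "\<dots> = (norm y *\<^sub>R w) \<bullet> (P *v (norm y *\<^sub>R w))"
        by (simp only: matrix_vector_mult_scaleR inner_scaleR_left inner_scaleR_right
            power2_eq_square mult.assoc)
      finally show ?thesis by (simp only: y[symmetric] mult.commute)
    qed auto
  qed
qed

lemma inner_symmetric_matrix:
  fixes P :: "real ^ 'm ^ 'm::finite"
  assumes "transpose P = P"
  shows "x \<bullet> (P *v y) = y \<bullet> (P *v x)"
proof -
  have "x \<bullet> (P *v y) = (transpose P *v x) \<bullet> y"
    by (simp only: transpose_matrix_vector dot_lmul_matrix)
  then show ?thesis by (simp only: assms inner_commute)
qed

text \<open>
  The constants depend only on \<open>P\<close>, \<open>\<alpha>\<close> and \<open>\<rho>\<close>. The curve \<open>y\<close> need not solve any particular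
  equation, so the estimate serves both for arbitrary solutions and for those of a modified vector field.
\<close>

lemma lyapunov_exp_estimate:
  fixes P :: "real ^ 'm ^ 'm::finite"
  assumes P: "pos_def P" and \<alpha>: "0 < \<alpha>" and \<rho>: "0 < \<rho>"
  obtains c K \<mu> where "0 < c" "0 < K" "0 < \<mu>"
    "\<And>T y y' t. (\<And>s. s \<in> {0..T} \<Longrightarrow> (y has_vector_derivative y' s) (at s within {0..T})) \<Longrightarrow>
       (\<And>s. s \<in> {0..T} \<Longrightarrow> norm (y s) \<le> \<rho> \<Longrightarrow> y s \<bullet> (P *v y' s) \<le> - \<alpha> * (norm (y s))\<^sup>2) \<Longrightarrow>
       norm (y 0) < c \<Longrightarrow> t \<in> {0..T} \<Longrightarrow>
       norm (y t) \<le> \<rho> \<and> norm (y t) \<le> K * exp (- \<mu> * t) * norm (y 0)"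
proof -
  obtain l where l: "0 < l" "\<And>y. l * (norm y)\<^sup>2 \<le> y \<bullet> (P *v y)"
    using pos_def_lower_bound[OF P] by blast
  obtain \<Lambda> where \<Lambda>: "0 < \<Lambda>" "\<And>y. norm (P *v y) \<le> norm y * \<Lambda>"
    using bounded_linear.pos_bounded[OF matrix_vector_mul_bounded_linear[of P]] by blast
  have upper: "y \<bullet> (P *v y) \<le> \<Lambda> * (norm y)\<^sup>2" for y
  proof -
    have "y \<bullet> (P *v y) \<le> norm y * norm (P *v y)" by (rule norm_cauchy_schwarz)
    also have "\<dots> \<le> norm y * (norm y * \<Lambda>)" by (intro mult_left_mono \<Lambda>) auto
    finally show ?thesis by (simp add: power2_eq_square mult_ac)
  qed
  have symm: "x \<bullet> (P *v y) = y \<bullet> (P *v x)" for x y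
    using P by (intro inner_symmetric_matrix) (simp add: pos_def_def)
  \<comment> \<open>\<open>K\<^sup>2\<close> is the ratio of the two bounds of the quadratic form; starting within \<open>\<rho> / K\<close> puts
      \<open>V 0\<close> below the level \<open>l * \<rho>\<^sup>2\<close>, below which \<open>y\<close> is confined to the ball of radius \<open>\<rho>\<close>.\<close>
  define K where "K = sqrt (\<Lambda> / l)"
  have K: "0 < K" "K\<^sup>2 = \<Lambda> / l" using l \<Lambda> by (auto simp: K_def)
  define \<mu> where "\<mu> = \<alpha> / \<Lambda>"
  have \<mu>: "0 < \<mu>" using \<alpha> \<Lambda> by (simp add: \<mu>_def)
  show thesis
  proof
    show "0 < \<rho> / K" "0 < K" "0 < \<mu>" using \<rho> K \<mu> by auto
    fix T :: real and y y' :: "real \<Rightarrow> real ^ 'm" and t :: real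
    assume der: "\<And>s. s \<in> {0..T} \<Longrightarrow> (y has_vector_derivative y' s) (at s within {0..T})"
      and neg: "\<And>s. s \<in> {0..T} \<Longrightarrow> norm (y s) \<le> \<rho> \<Longrightarrow> y s \<bullet> (P *v y' s) \<le> - \<alpha> * (norm (y s))\<^sup>2"
      and y0: "norm (y 0) < \<rho> / K" and t: "t \<in> {0..T}"
    define V where "V s = y s \<bullet> (P *v y s)" for s
    have V_bounds: "l * (norm (y s))\<^sup>2 \<le> V s" "V s \<le> \<Lambda> * (norm (y s))\<^sup>2" for s
      using l upper by (auto simp: V_def)
    have V_nonneg: "0 \<le> V s" for s
      using V_bounds(1)[of s] l by (meson mult_nonneg_nonneg order.trans less_imp_le zero_le_power2)
    have "V t \<le> exp (- (2 * \<mu>) * t) * V 0"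
    proof (rule exp_decay_below_level[where T = T and V' = "\<lambda>s. 2 * (y s \<bullet> (P *v y' s))" and r = "l * \<rho>\<^sup>2"])
      fix s assume s: "s \<in> {0..T}"
      have "((\<lambda>s. P *v y s) has_vector_derivative P *v y' s) (at s within {0..T})"
        by (rule bounded_linear.has_vector_derivative[OF matrix_vector_mul_bounded_linear der[OF s]])
      then have "(V has_vector_derivative y s \<bullet> (P *v y' s) + y' s \<bullet> (P *v y s)) (at s within {0..T})"
        unfolding V_def
        by (rule bounded_bilinear.has_vector_derivative[OF bounded_bilinear_inner der[OF s]])
      then show "(V has_real_derivative 2 * (y s \<bullet> (P *v y' s))) (at s within {0..T})"
        by (simp add: has_real_derivative_iff_has_vector_derivative symm[of "y' s"])
      assume "V s < l * \<rho>\<^sup>2"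
      then have "l * (norm (y s))\<^sup>2 < l * \<rho>\<^sup>2" using V_bounds(1)[of s] by linarith
      then have "(norm (y s))\<^sup>2 \<le> \<rho>\<^sup>2" using l(1) by simp
      then have "norm (y s) \<le> \<rho>" by (rule power2_le_imp_le) (use \<rho> in simp)
      then have "2 * (y s \<bullet> (P *v y' s)) \<le> - 2 * \<alpha> * (norm (y s))\<^sup>2" using neg[OF s] by linarith
      also have "\<dots> \<le> - (2 * \<mu>) * V s"
        using V_bounds(2)[of s] \<alpha> \<Lambda> by (simp add: \<mu>_def field_simps)
      finally show "2 * (y s \<bullet> (P *v y' s)) \<le> - (2 * \<mu>) * V s" .
    next
      have "K * norm (y 0) < \<rho>" using y0 K by (simp add: field_simps)
      then have "(K * norm (y 0))\<^sup>2 < \<rho>\<^sup>2" using K by (intro power_strict_mono) auto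
      then have "\<Lambda> * (norm (y 0))\<^sup>2 < l * \<rho>\<^sup>2"
        using l(1) by (simp add: power_mult_distrib K field_simps)
      then show "V 0 < l * \<rho>\<^sup>2" using V_bounds(2)[of 0] by linarith
    qed (use t \<mu> V_nonneg in auto)
    then have "l * (norm (y t))\<^sup>2 \<le> exp (- (2 * \<mu>) * t) * V 0"
      using V_bounds(1)[of t] by linarith
    also have "\<dots> \<le> exp (- (2 * \<mu>) * t) * (\<Lambda> * (norm (y 0))\<^sup>2)"
      by (intro mult_left_mono V_bounds) auto
    also have "exp (- (2 * \<mu>) * t) = (exp (- \<mu> * t))\<^sup>2"
      by (simp flip: exp_double)
    finally have "(norm (y t))\<^sup>2 \<le> (K * exp (- \<mu> * t) * norm (y 0))\<^sup>2"
      using l(1) by (simp add: power_mult_distrib K field_simps)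
    then have est: "norm (y t) \<le> K * exp (- \<mu> * t) * norm (y 0)"
      by (rule power2_le_imp_le) (use K in simp)
    also have "\<dots> \<le> K * 1 * norm (y 0)"
      using K t \<mu> by (intro mult_right_mono mult_left_mono) auto
    also have "\<dots> \<le> \<rho>" using y0 K by (simp add: field_simps)
    finally show "norm (y t) \<le> \<rho> \<and> norm (y t) \<le> K * exp (- \<mu> * t) * norm (y 0)"
      using est by simp
  qed
qed

text \<open>
  The Lipschitz condition is used only for the existence of solutions; the bound on solutions
  needs no more than differentiability at the equilibrium.
\<close>

theorem lyapunov_indirect_method:
  fixes f J :: "real ^ 'm::finite \<Rightarrow> real ^ 'm"
  assumes eq: "f xe = 0" and deriv: "(f has_derivative J) (at xe)"
    and lip: "L-lipschitz_on (cball xe \<rho>) f" and \<rho>: "0 < \<rho>" and S: "cball xe \<rho> \<subseteq> S"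
    and P: "pos_def P" and \<alpha>: "0 < \<alpha>" and neg: "\<And>z. z \<bullet> (P *v J z) \<le> - \<alpha> * (norm z)\<^sup>2"
  shows "locally_exp_stable f S xe"
proof -
  obtain \<Lambda> where \<Lambda>: "0 < \<Lambda>" "\<And>z. norm (P *v z) \<le> norm z * \<Lambda>"
    using bounded_linear.pos_bounded[OF matrix_vector_mul_bounded_linear[of P]] by blast
  obtain d where d: "0 < d"
      "\<And>z. norm z < d \<Longrightarrow> norm (f (xe + z) - J z) \<le> \<alpha> / (2 * \<Lambda>) * norm z"
  proof -
    have "0 < \<alpha> / (2 * \<Lambda>)" using \<alpha> \<Lambda> by simp
    then obtain d where "0 < d"
        "\<And>x. norm (x - xe) < d \<Longrightarrow> norm (f x - f xe - J (x - xe)) \<le> \<alpha> / (2 * \<Lambda>) * norm (x - xe)"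
      using deriv unfolding has_derivative_at_alt by blast
    from this(1) this(2)[of "xe + _"] show thesis
      by (intro that) (auto simp: eq)
  qed
  define \<sigma> where "\<sigma> = min \<rho> (d / 2)"
  have \<sigma>: "0 < \<sigma>" "\<sigma> \<le> \<rho>" "\<sigma> < d" using \<rho> d by (auto simp: \<sigma>_def)
  have decay: "z \<bullet> (P *v f (xe + z)) \<le> - (\<alpha> / 2) * (norm z)\<^sup>2" if "norm z \<le> \<sigma>" for z
  proof -
    have "z \<bullet> (P *v (f (xe + z) - J z)) \<le> norm z * norm (P *v (f (xe + z) - J z))"
      by (rule norm_cauchy_schwarz)
    also have "\<dots> \<le> norm z * (norm (f (xe + z) - J z) * \<Lambda>)"
      by (intro mult_left_mono \<Lambda>) auto
    also have "\<dots> \<le> norm z * ((\<alpha> / (2 * \<Lambda>) * norm z) * \<Lambda>)"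
      using d(2)[of z] that \<sigma> \<Lambda> by (intro mult_left_mono mult_right_mono) auto
    also have "\<dots> = \<alpha> / 2 * (norm z)\<^sup>2"
      using \<Lambda> by (simp add: power2_eq_square)
    finally have "z \<bullet> (P *v (f (xe + z) - J z)) \<le> \<alpha> / 2 * (norm z)\<^sup>2" .
    with neg[of z] show ?thesis
      by (simp add: matrix_vector_mult_diff_distrib inner_diff_right)
  qed
  obtain c K \<mu> where pos: "0 < c" "0 < K" "0 < \<mu>"
    and est: "\<And>T y y' t. (\<And>s. s \<in> {0..T} \<Longrightarrow> (y has_vector_derivative y' s) (at s within {0..T})) \<Longrightarrow>
       (\<And>s. s \<in> {0..T} \<Longrightarrow> norm (y s) \<le> \<sigma> \<Longrightarrow> y s \<bullet> (P *v y' s) \<le> - (\<alpha> / 2) * (norm (y s))\<^sup>2) \<Longrightarrow>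
       norm (y 0) < c \<Longrightarrow> t \<in> {0..T} \<Longrightarrow>
       norm (y t) \<le> \<sigma> \<and> norm (y t) \<le> K * exp (- \<mu> * t) * norm (y 0)"
    using lyapunov_exp_estimate[OF P half_gt_zero[OF \<alpha>] \<sigma>(1)] by blast
  have global: "\<exists>x. x 0 = x0 \<and> ode_solution f S {0..} x" if x0: "norm (x0 - xe) < c" for x0
  proof -
    \<comment> \<open>Precomposing with the projection onto the ball gives a globally Lipschitz field that agrees
        with \<open>f\<close> on the ball.\<close>
    define pr where "pr = closest_point (cball (0 :: real ^ 'm) \<sigma>)"
    have pr_ball: "norm (pr z) \<le> \<sigma>" for z
      using closest_point_in_set[of "cball (0 :: real ^ 'm) \<sigma>" z] \<sigma> by (simp add: pr_def)
    have pr_self: "pr z = z" if "norm z \<le> \<sigma>" for z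
      using that by (simp add: pr_def closest_point_self)
    have pr_lip: "norm (pr z - pr w) \<le> norm (z - w)" for z w
      using closest_point_lipschitz[of "cball (0 :: real ^ 'm) \<sigma>" z w] \<sigma>
      by (simp add: pr_def dist_norm)
    define g where "g z = f (xe + pr z)" for z
    have "L-lipschitz_on UNIV g"
    proof (rule lipschitz_onI)
      fix z w
      have "dist (g z) (g w) \<le> L * dist (xe + pr z) (xe + pr w)"
        using pr_ball[of z] pr_ball[of w] \<sigma> unfolding g_def
        by (intro lipschitz_onD[OF lip]) (auto simp: dist_norm)
      also have "\<dots> \<le> L * dist z w"
        using pr_lip[of z w] by (intro mult_left_mono lipschitz_on_nonneg[OF lip]) (auto simp: dist_norm)
      finally show "dist (g z) (g w) \<le> L * dist z w" .
    qed (rule lipschitz_on_nonneg[OF lip])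
    then obtain y where y0: "y 0 = x0 - xe"
      and y: "\<And>t. 0 \<le> t \<Longrightarrow> (y has_vector_derivative g (y t)) (at t within {0..})"
      using lipschitz_ode_global_solution by blast
    have y_ball: "norm (y t) \<le> \<sigma>" if t: "0 \<le> t" for t
    proof -
      have "norm (y t) \<le> \<sigma> \<and> norm (y t) \<le> K * exp (- \<mu> * t) * norm (y 0)"
      proof (rule est[where T = t and y' = "\<lambda>s. g (y s)"])
        fix s assume "s \<in> {0..t}"
        then show "(y has_vector_derivative g (y s)) (at s within {0..t})"
          by (intro has_vector_derivative_within_subset[OF y]) auto
        assume "norm (y s) \<le> \<sigma>"
        then show "y s \<bullet> (P *v g (y s)) \<le> - (\<alpha> / 2) * (norm (y s))\<^sup>2"
          using decay by (simp add: g_def pr_self)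
      qed (use t x0 y0 in auto)
      then show ?thesis ..
    qed
    have "ode_solution f S {0..} (\<lambda>t. xe + y t)"
      unfolding ode_solution_def
    proof (intro ballI conjI)
      fix t :: real assume "t \<in> {0..}"
      then have t: "0 \<le> t" by simp
      show "xe + y t \<in> S"
        using S y_ball[OF t] \<sigma> by (auto simp: dist_norm)
      have "((\<lambda>t. xe + y t) has_vector_derivative 0 + g (y t)) (at t within {0..})"
        by (intro has_vector_derivative_add y t) auto
      then show "((\<lambda>t. xe + y t) has_vector_derivative f (xe + y t)) (at t within {0..})"
        by (simp add: g_def pr_self y_ball t)
    qed
    then show ?thesis using y0 by (intro exI[of _ "\<lambda>t. xe + y t"]) auto
  qed
  have bound: "norm (x t - xe) \<le> K * exp (- \<mu> * t) * norm (x0 - xe)"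
    if x0: "norm (x0 - xe) < c" and x: "x 0 = x0" "ode_solution f S {0..T} x" and t: "t \<in> {0..T}"
    for x0 T x t
  proof -
    have "norm (x t - xe) \<le> \<sigma> \<and> norm (x t - xe) \<le> K * exp (- \<mu> * t) * norm (x 0 - xe)"
    proof (rule est[where T = T and y = "\<lambda>t. x t - xe" and y' = "\<lambda>s. f (x s)"])
      fix s assume s: "s \<in> {0..T}"
      have "((\<lambda>t. x t - xe) has_vector_derivative f (x s) - 0) (at s within {0..T})"
        using x(2) s by (intro has_vector_derivative_diff) (auto simp: ode_solution_def)
      then show "((\<lambda>t. x t - xe) has_vector_derivative f (x s)) (at s within {0..T})" by simp
      show "norm (x s - xe) \<le> \<sigma> \<Longrightarrow> (x s - xe) \<bullet> (P *v f (x s)) \<le> - (\<alpha> / 2) * (norm (x s - xe))\<^sup>2"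
        using decay[of "x s - xe"] by simp
    qed (use x0 x t in auto)
    then show ?thesis using x by simp
  qed
  have "xe \<in> S" using S \<rho> by auto
  with eq pos global bound show ?thesis
    unfolding locally_exp_stable_def by blast
qed

section \<open>Derivative and Lipschitz property of the microgrid field\<close>

lemma diag_unit_mult_vec: "diag_unit m *v z = (z $ m) *\<^sub>R axis m 1"
proof -
  have "(\<Sum>j\<in>UNIV. (if i = m \<and> j = m then 1 else 0) * z $ j) = (if i = m then z $ m else 0)" for i
    by (cases "i = m") (simp_all add: if_distrib[of "\<lambda>u. u * _"] cong: if_cong)
  then show ?thesis
    by (simp add: vec_eq_iff diag_unit_def matrix_vector_mult_def axis_def)
qed

text \<open>
  Splitting the load part into one term for each bus reduces differentiability and the Lipschitz
  property of the vector field to those of a reciprocal of a coordinate.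
\<close>

lemma mg_field_load_terms:
  "mg_field M vref p x = A_mat M *v x + B_mat M *v vref +
     (\<Sum>k\<in>UNIV. inverse (x $ VL k) *\<^sub>R ((- p $ k / Cl M k) *\<^sub>R axis (VL k) 1))"
proof -
  have "C_mat M *v load_h p x = (\<Sum>k\<in>UNIV. inverse (x $ VL k) *\<^sub>R ((- p $ k / Cl M k) *\<^sub>R axis (VL k) 1))"
    unfolding vec_eq_iff
    by (simp add: C_mat_def load_h_def matrix_vector_mult_def axis_def field_simps)
       (auto intro!: sum.cong simp: field_simps)
  then show ?thesis by (simp add: mg_field_def)
qed

text \<open>
  The Jacobian of the vector field; it depends on the state only through the load voltages, which
  must be nonzero for the definition to be meaningful.
\<close>

definition mg_jacobian ::
  "'n::finite microgrid \<Rightarrow> real ^ 'n \<Rightarrow> real ^ 'n coord \<Rightarrow> real ^ 'n coord ^ 'n coord" where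
  "mg_jacobian M p x =
     A_mat M + (\<Sum>k\<in>UNIV. (p $ k / (Cl M k * (x $ VL k)\<^sup>2)) *\<^sub>R diag_unit (VL k))"

lemma sum_matrix_mult_vec: "(\<Sum>k\<in>I. Q k) *v z = (\<Sum>k\<in>I. Q k *v (z :: real ^ 'm::finite))"
  by (induction I rule: infinite_finite_induct) (simp_all add: matrix_vector_mult_add_rdistrib)

lemma add_diag_units_mult_vec:
  fixes Q :: "real ^ 'n coord ^ 'n::finite coord"
  shows "(Q + (\<Sum>k\<in>UNIV. d k *\<^sub>R diag_unit (VL k))) *v z =
    Q *v z + (\<Sum>k\<in>UNIV. d k *\<^sub>R (diag_unit (VL k) *v z))"
  by (simp add: matrix_vector_mult_add_rdistrib sum_matrix_mult_vec scaleR_matrix_vector_assoc)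

lemma has_derivative_inverse_component:
  fixes x :: "real ^ 'm::finite" and v :: "'a::real_normed_vector"
  assumes "x $ i \<noteq> 0"
  shows "((\<lambda>x. inverse (x $ i) *\<^sub>R v) has_derivative (\<lambda>z. (- (z $ i / (x $ i)\<^sup>2)) *\<^sub>R v)) (at x)"
proof -
  have "((\<lambda>x. x $ i) has_derivative (\<lambda>z. z $ i)) (at x)"
    by (rule bounded_linear_imp_has_derivative[OF bounded_linear_vec_nth])
  from has_derivative_scaleR_left[OF Deriv.has_derivative_inverse[OF assms this], of v]
  show ?thesis by (simp add: power2_eq_square divide_inverse mult_ac)
qed

lemma mg_field_has_derivative:
  fixes M :: "'n::finite microgrid"
  assumes "x \<in> mg_domain"
  shows "(mg_field M vref p has_derivative (*v) (mg_jacobian M p x)) (at x)"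
proof -
  have "((\<lambda>x. A_mat M *v x + B_mat M *v vref +
      (\<Sum>k\<in>UNIV. inverse (x $ VL k) *\<^sub>R ((- p $ k / Cl M k) *\<^sub>R axis (VL k) 1)))
    has_derivative (\<lambda>z. A_mat M *v z + 0 +
      (\<Sum>k\<in>UNIV. (- (z $ VL k / (x $ VL k)\<^sup>2)) *\<^sub>R ((- p $ k / Cl M k) *\<^sub>R axis (VL k) 1)))) (at x)"
    using assms
    by (intro has_derivative_add has_derivative_sum has_derivative_const has_derivative_inverse_component
        bounded_linear_imp_has_derivative matrix_vector_mul_bounded_linear) (auto simp: mg_domain_def)
  moreover have "(\<lambda>z. A_mat M *v z + 0 +
      (\<Sum>k\<in>UNIV. (- (z $ VL k / (x $ VL k)\<^sup>2)) *\<^sub>R ((- p $ k / Cl M k) *\<^sub>R axis (VL k) 1))) =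
    (*v) (mg_jacobian M p x)"
    by (simp add: fun_eq_iff mg_jacobian_def add_diag_units_mult_vec diag_unit_mult_vec mult_ac)
  ultimately show ?thesis by (simp add: mg_field_load_terms[abs_def])
qed

lemma lipschitz_on_inverse_component:
  fixes v :: "'a::real_normed_vector" and U :: "(real ^ 'm::finite) set"
  assumes a: "0 < a" and U: "\<And>x. x \<in> U \<Longrightarrow> a \<le> x $ i"
  shows "(norm v / a\<^sup>2)-lipschitz_on U (\<lambda>x. inverse (x $ i) *\<^sub>R v)"
proof (rule lipschitz_onI)
  fix x y :: "real ^ 'm" assume xy: "x \<in> U" "y \<in> U"
  have pos: "0 < x $ i" "0 < y $ i" using less_le_trans[OF a U] xy by blast+
  have "dist (inverse (x $ i) *\<^sub>R v) (inverse (y $ i) *\<^sub>R v) = \<bar>inverse (x $ i) - inverse (y $ i)\<bar> * norm v"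
    by (simp add: dist_norm flip: scaleR_diff_left)
  also have "inverse (x $ i) - inverse (y $ i) = (y $ i - x $ i) / (x $ i * y $ i)"
    using pos by (simp add: field_simps)
  also have "\<bar>(y $ i - x $ i) / (x $ i * y $ i)\<bar> * norm v \<le> (dist x y / a\<^sup>2) * norm v"
  proof (rule mult_right_mono)
    have "\<bar>y $ i - x $ i\<bar> \<le> dist x y"
      using component_le_norm_cart[of "y - x" i] by (simp add: dist_norm norm_minus_commute)
    moreover have "a\<^sup>2 \<le> x $ i * y $ i"
      unfolding power2_eq_square using a U xy pos by (intro mult_mono) auto
    ultimately show "\<bar>(y $ i - x $ i) / (x $ i * y $ i)\<bar> \<le> dist x y / a\<^sup>2"
      using a pos by (auto simp: abs_mult intro!: frac_le)
  qed simp
  finally show "dist (inverse (x $ i) *\<^sub>R v) (inverse (y $ i) *\<^sub>R v) \<le> norm v / a\<^sup>2 * dist x y"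
    by (simp add: mult_ac)
qed simp

lemma lipschitz_on_sum_exists:
  fixes f :: "'k \<Rightarrow> 'a::metric_space \<Rightarrow> 'b::real_normed_vector"
  assumes "\<And>k. k \<in> I \<Longrightarrow> \<exists>L. L-lipschitz_on U (f k)"
  shows "\<exists>L. L-lipschitz_on U (\<lambda>x. \<Sum>k\<in>I. f k x)"
  using assms
proof (induction I rule: infinite_finite_induct)
  case (insert k I)
  obtain L where "L-lipschitz_on U (f k)" using insert.prems by blast
  moreover obtain L' where "L'-lipschitz_on U (\<lambda>x. \<Sum>k\<in>I. f k x)"
    using insert.IH insert.prems by blast
  ultimately have "(L + L')-lipschitz_on U (\<lambda>x. f k x + (\<Sum>k\<in>I. f k x))"
    by (rule lipschitz_on_add)
  then show ?case using insert.hyps by auto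
qed (auto intro: lipschitz_on_constant)

lemma mg_field_lipschitz_near:
  fixes M :: "'n::finite microgrid"
  assumes pos: "\<And>k. 0 < x $ VL k"
  obtains L \<rho> where "0 < \<rho>" "cball x \<rho> \<subseteq> mg_domain" "L-lipschitz_on (cball x \<rho>) (mg_field M vref p)"
proof -
  \<comment> \<open>Within half the smallest load voltage, every load voltage is still at least \<open>\<rho>\<close>.\<close>
  define \<rho> where "\<rho> = Min (range (\<lambda>k. x $ VL k)) / 2"
  have \<rho>: "0 < \<rho>" using pos by (simp add: \<rho>_def)
  have lower: "\<rho> \<le> y $ VL k" if y: "y \<in> cball x \<rho>" for y k
  proof -
    have "2 * \<rho> \<le> x $ VL k" by (simp add: \<rho>_def)
    moreover have "\<bar>x $ VL k - y $ VL k\<bar> \<le> \<rho>"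
      using component_le_norm_cart[of "x - y" "VL k"] y by (simp add: dist_norm)
    ultimately show ?thesis by linarith
  qed
  obtain L1 where L1: "L1-lipschitz_on UNIV ((*v) (A_mat M))"
    using bounded_linear.lipschitz_boundE[OF matrix_vector_mul_bounded_linear] by blast
  have "\<exists>L. L-lipschitz_on (cball x \<rho>)
      (\<lambda>x. inverse (x $ VL k) *\<^sub>R ((- p $ k / Cl M k) *\<^sub>R axis (VL k) (1 :: real)))" for k
    by (rule exI, rule lipschitz_on_inverse_component[OF \<rho> lower])
  then have "\<exists>L. L-lipschitz_on (cball x \<rho>)
      (\<lambda>x. \<Sum>k\<in>UNIV. inverse (x $ VL k) *\<^sub>R ((- p $ k / Cl M k) *\<^sub>R axis (VL k) (1 :: real)))"
    by (rule lipschitz_on_sum_exists)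
  then obtain L2 where "L2-lipschitz_on (cball x \<rho>)
      (\<lambda>x. \<Sum>k\<in>UNIV. inverse (x $ VL k) *\<^sub>R ((- p $ k / Cl M k) *\<^sub>R axis (VL k) (1 :: real)))"
    by blast
  then have "(L1 + 0 + L2)-lipschitz_on (cball x \<rho>) (\<lambda>x. A_mat M *v x + B_mat M *v vref +
     (\<Sum>k\<in>UNIV. inverse (x $ VL k) *\<^sub>R ((- p $ k / Cl M k) *\<^sub>R axis (VL k) 1)))"
    by (intro lipschitz_on_add lipschitz_on_constant lipschitz_on_subset[OF L1]) auto
  then have lip: "(L1 + 0 + L2)-lipschitz_on (cball x \<rho>) (mg_field M vref p)"
    by (simp only: mg_field_load_terms[abs_def])
  have "y $ VL k \<noteq> 0" if "y \<in> cball x \<rho>" for y k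
    using lower[OF that, of k] \<rho> by linarith
  then have "cball x \<rho> \<subseteq> mg_domain"
    unfolding mg_domain_def by blast
  with \<rho> lip show thesis using that by blast
qed

section \<open>Robust stability from the matrix inequalities\<close>

lemma quadratic_form_lyapunov:
  fixes P Q :: "real ^ 'm ^ 'm::finite"
  assumes "transpose P = P"
  shows "z \<bullet> ((P ** Q + transpose Q ** P) *v z) = 2 * (z \<bullet> (P *v (Q *v z)))"
proof -
  have "z \<bullet> (transpose Q *v (P *v z)) = (Q *v z) \<bullet> (P *v z)"
    by (metis dot_lmul_matrix transpose_matrix_vector transpose_transpose inner_commute)
  then show ?thesis
    using inner_symmetric_matrix[OF assms, of z "Q *v z"]
    by (simp add: matrix_vector_mult_add_rdistrib inner_add_right flip: matrix_vector_mul_assoc)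
qed

lemma inner_scaled_identity:
  fixes z :: "real ^ 'm::finite"
  shows "z \<bullet> ((c *\<^sub>R mat 1) *v z) = c * (norm z)\<^sup>2"
  by (simp add: power2_norm_eq_inner flip: scaleR_matrix_vector_assoc)

lemma loewner_leD: "Q \<preceq>\<^sub>L R \<Longrightarrow> z \<bullet> (Q *v z) \<le> z \<bullet> (R *v z)"
  by (simp add: loewner_le_def pos_semidef_def matrix_vector_mult_diff_rdistrib inner_diff_right)

lemma transpose_diag_unit: "transpose (diag_unit m) = diag_unit m"
  by (auto simp: transpose_def diag_unit_def vec_eq_iff)

text \<open>
  The contribution of one load: with \<open>\<theta> = (\<delta> - d) / \<delta>\<close>, the inequality for the worst-case load is
  scaled by \<open>\<theta> \<in> {0..1}\<close>. If \<open>\<delta> = 0\<close>, then \<open>d = 0\<close> and the right-hand side vanishes.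
\<close>

lemma partial_load_bound:
  fixes d \<delta> q s \<gamma> \<eta> :: real
  assumes "0 \<le> d" "d \<le> \<delta>" "(\<gamma> - \<eta>) * s \<le> \<delta> * q" "0 \<le> s"
  shows "(min \<gamma> \<eta> - \<eta>) * s \<le> (\<delta> - d) * q"
proof (cases "\<delta> = 0")
  case True
  then show ?thesis using assms by (auto intro: mult_nonpos_nonneg)
next
  case False
  define \<theta> where "\<theta> = (\<delta> - d) / \<delta>"
  have \<theta>: "0 \<le> \<theta>" "\<theta> \<le> 1" using assms False by (auto simp: \<theta>_def)
  have "min \<gamma> \<eta> - \<eta> \<le> \<theta> * (\<gamma> - \<eta>)"
  proof (cases "\<gamma> \<le> \<eta>")
    case True
    then show ?thesis using \<theta> mult_right_mono_neg[of \<theta> 1 "\<gamma> - \<eta>"] by simp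
  next
    case False
    then show ?thesis using \<theta> by simp
  qed
  then have "(min \<gamma> \<eta> - \<eta>) * s \<le> \<theta> * ((\<gamma> - \<eta>) * s)"
    using assms(4) mult_right_mono by (fastforce simp: mult.assoc)
  also have "\<dots> \<le> \<theta> * (\<delta> * q)"
    using assms \<theta> by (intro mult_left_mono) auto
  also have "\<dots> = (\<delta> - d) * q" using False by (simp add: \<theta>_def)
  finally show ?thesis .
qed

lemma jacobian_lyapunov_inequality:
  fixes P :: "real ^ 'n coord ^ 'n::finite coord"
  assumes P: "transpose P = P"
    and lyap: "P ** Az_bar M p_hi v_lo + transpose (Az_bar M p_hi v_lo) ** P \<preceq>\<^sub>L - (\<Sum>k\<in>UNIV. \<eta> k) *\<^sub>R mat 1"
    and G: "\<And>k. (\<gamma> k - \<eta> k) *\<^sub>R mat 1 \<preceq>\<^sub>L delta_bar M p_hi v_lo k *\<^sub>R G_mat P k"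
    and load: "\<And>k. 0 \<le> p $ k / (Cl M k * (x $ VL k)\<^sup>2)"
      "\<And>k. p $ k / (Cl M k * (x $ VL k)\<^sup>2) \<le> delta_bar M p_hi v_lo k"
  shows "z \<bullet> (P *v (mg_jacobian M p x *v z)) \<le> - ((\<Sum>k\<in>UNIV. min (\<gamma> k) (\<eta> k)) / 2) * (norm z)\<^sup>2"
proof -
  define d where "d k = p $ k / (Cl M k * (x $ VL k)\<^sup>2)" for k
  define \<delta> where "\<delta> = delta_bar M p_hi v_lo"
  define q where "q k = 2 * (z \<bullet> (P *v (diag_unit (VL k) *v z)))" for k
  define A where "A = Az_bar M p_hi v_lo"
  have Az: "2 * (z \<bullet> (P *v (A *v z))) \<le> - (\<Sum>k\<in>UNIV. \<eta> k) * (norm z)\<^sup>2"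
    using loewner_leD[OF lyap, of z] quadratic_form_lyapunov[OF P, of z A]
    by (simp only: A_def inner_scaled_identity)
  have "z \<bullet> (G_mat P k *v z) = q k" for k
    using quadratic_form_lyapunov[OF P, of z "diag_unit (VL k)"]
    by (simp add: G_mat_def q_def transpose_diag_unit)
  then have "(\<gamma> k - \<eta> k) * (norm z)\<^sup>2 \<le> \<delta> k * q k" for k
    using loewner_leD[OF G, of z k]
    unfolding inner_scaled_identity by (simp add: \<delta>_def flip: scaleR_matrix_vector_assoc)
  then have "(min (\<gamma> k) (\<eta> k) - \<eta> k) * (norm z)\<^sup>2 \<le> (\<delta> k - d k) * q k" for k
    using load[of k] by (intro partial_load_bound) (auto simp: d_def \<delta>_def)
  then have "(\<Sum>k\<in>UNIV. (min (\<gamma> k) (\<eta> k) - \<eta> k) * (norm z)\<^sup>2) \<le> (\<Sum>k\<in>UNIV. (\<delta> k - d k) * q k)"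
    by (rule sum_mono)
  then have sum: "(\<Sum>k\<in>UNIV. min (\<gamma> k) (\<eta> k)) * (norm z)\<^sup>2 - (\<Sum>k\<in>UNIV. \<eta> k) * (norm z)\<^sup>2
      \<le> (\<Sum>k\<in>UNIV. (\<delta> k - d k) * q k)"
    by (simp add: left_diff_distrib sum_subtractf flip: sum_distrib_right)
  have "mg_jacobian M p x *v z = A *v z - (\<Sum>k\<in>UNIV. (\<delta> k - d k) *\<^sub>R (diag_unit (VL k) *v z))"
    by (simp add: A_def mg_jacobian_def Az_bar_def add_diag_units_mult_vec d_def \<delta>_def
        scaleR_diff_left sum_subtractf)
  then have "2 * (z \<bullet> (P *v (mg_jacobian M p x *v z))) =
      2 * (z \<bullet> (P *v (A *v z))) - (\<Sum>k\<in>UNIV. (\<delta> k - d k) * q k)"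
    by (simp add: matrix_vector_mult_diff_distrib linear_sum[OF matrix_vector_mul_linear]
        matrix_vector_mult_scaleR inner_diff_right inner_sum_right q_def sum_distrib_left mult_ac)
  then show ?thesis using Az sum by (simp add: left_diff_distrib)
qed

theorem proposition1:
  fixes M :: "'n::finite microgrid"
    and vref p_lo p_hi v_lo v_hi :: "real ^ 'n"
  assumes "wf_microgrid M"
    and "\<And>k. 0 \<le> p_lo $ k \<and> p_lo $ k \<le> p_hi $ k"
    and "\<And>k. 0 < v_lo $ k \<and> v_lo $ k \<le> v_hi $ k"
    and feasible:
      "\<exists>(P :: real ^ 'n coord ^ 'n coord) (\<gamma>0 :: real) (\<gamma> :: 'n \<Rightarrow> real) (\<eta> :: 'n \<Rightarrow> real).
         P ** Az_bar M p_hi v_lo + transpose (Az_bar M p_hi v_lo) ** P \<preceq>\<^sub>L - \<gamma>0 *\<^sub>R mat 1 \<and>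
         (\<Sum>k\<in>UNIV. \<eta> k) = \<gamma>0 \<and>
         (\<forall>k. (\<gamma> k - \<eta> k) *\<^sub>R mat 1 \<preceq>\<^sub>L delta_bar M p_hi v_lo k *\<^sub>R G_mat P k) \<and>
         (\<forall>k. \<gamma> k > 0 \<and> \<eta> k > 0) \<and>
         transpose P = P \<and> pos_def P \<and> \<gamma>0 > 0"
  shows "locally_robustly_stable M vref (box_set p_lo p_hi) (box_set v_lo v_hi)"
  unfolding locally_robustly_stable_def
proof (intro ballI impI)
  fix xe :: "real ^ 'n coord" and p :: "real ^ 'n"
  assume xe: "xe \<in> equilibria M vref (box_set p_lo p_hi) (box_set v_lo v_hi)"
    and p: "p \<in> box_set p_lo p_hi" and eq: "mg_field M vref p xe = 0"
  obtain P :: "real ^ 'n coord ^ 'n coord" and \<gamma> \<eta> :: "'n \<Rightarrow> real" where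
      lyap: "P ** Az_bar M p_hi v_lo + transpose (Az_bar M p_hi v_lo) ** P \<preceq>\<^sub>L - (\<Sum>k\<in>UNIV. \<eta> k) *\<^sub>R mat 1"
      and G: "\<And>k. (\<gamma> k - \<eta> k) *\<^sub>R mat 1 \<preceq>\<^sub>L delta_bar M p_hi v_lo k *\<^sub>R G_mat P k"
      and pos: "\<And>k. 0 < \<gamma> k" "\<And>k. 0 < \<eta> k" and P: "transpose P = P" "pos_def P"
    using feasible by blast
  have v: "v_lo $ k \<le> xe $ VL k" "0 < xe $ VL k" for k
    using xe assms(3)[of k] by (auto simp: equilibria_def box_set_def load_voltages_def intro: less_le_trans)
  have p_bounds: "0 \<le> p $ k" "p $ k \<le> p_hi $ k" for k
    using p assms(2)[of k] by (auto simp: box_set_def intro: order_trans)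
  have Cl: "0 < Cl M k" for k using assms(1) by (simp add: wf_microgrid_def)
  have load: "0 \<le> p $ k / (Cl M k * (xe $ VL k)\<^sup>2)"
      "p $ k / (Cl M k * (xe $ VL k)\<^sup>2) \<le> delta_bar M p_hi v_lo k" for k
  proof -
    show "0 \<le> p $ k / (Cl M k * (xe $ VL k)\<^sup>2)"
      using p_bounds[of k] Cl[of k] by simp
    have "(v_lo $ k)\<^sup>2 \<le> (xe $ VL k)\<^sup>2"
      using v[of k] assms(3)[of k] by (intro power_mono) auto
    then show "p $ k / (Cl M k * (xe $ VL k)\<^sup>2) \<le> delta_bar M p_hi v_lo k"
      unfolding delta_bar_def
      using p_bounds[of k] Cl[of k] assms(3)[of k] by (intro frac_le mult_left_mono) auto
  qed
  obtain L \<rho> where \<rho>: "0 < \<rho>" "cball xe \<rho> \<subseteq> mg_domain"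
      and lip: "L-lipschitz_on (cball xe \<rho>) (mg_field M vref p)"
    using mg_field_lipschitz_near[OF v(2)] by blast
  have "xe \<in> mg_domain" using \<rho> by auto
  then have deriv: "(mg_field M vref p has_derivative (*v) (mg_jacobian M p xe)) (at xe)"
    by (rule mg_field_has_derivative)
  have "0 < (\<Sum>k\<in>UNIV. min (\<gamma> k) (\<eta> k)) / 2"
    using pos by (intro half_gt_zero sum_pos) auto
  with eq deriv lip \<rho> P(2) show "locally_exp_stable (mg_field M vref p) mg_domain xe"
    by (rule lyapunov_indirect_method) (rule jacobian_lyapunov_inequality[OF P(1) lyap G load])
qed

end
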